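(* Let $g:\mathbb{R}^n\to\mathbb{R}^m$ and $h:\mathbb{R}^n\to\mathbb{R}^p$ (and the objective $f:\mathbb{R}^n\to\mathbb{R}$) be continuously differentiable and let $\kappa$ be a positive integer. Let $(x^*,y^* )\in\mathbb{R}^n\times\mathbb{R}^n$ be feasible for problem (P) and let CC-MFCQ hold at $(x^*,y^* )$. Then there is a neighborhood $\mathcal{U}$ of $(x^*,y^* )$ such that for all $t>0$ the standard Mangasarian-Fromovitz constraint qualification (MFCQ) for $\mathrm{NLP}(t)$ holds at every $(x,y)\in\mathcal{U}$ that is feasible for $\mathrm{NLP}(t)$.
   Context: Notation: $e\in\mathbb{R}^n$ is the vector of all ones, $e_i$ the $i$-th unit vector of $\mathbb{R}^n$, $x\circ y$ the componentwise product; vector inequalities are componentwise. $I_g(x)=\{i\mid g_i(x)=0\}$ and $I_0(x)=\{i\mid x_i=0\}$. Problem (P) (continuous reformulation of the cardinality constrained problem $\min f(x)$ s.t. $g(x)\le 0$, $h(x)=0$, $|\{i: x_i\ne 0\}|\le\kappa$): $$\min_{x,y\in\mathbb{R}^n} f(x)\quad\text{s.t.}\quad g(x)\le 0,\ h(x)=0,\ 0\le y\le e,\ x\circ y=0,\ e^\top y\ge n-\kappa.$$ Regularized problem $\mathrm{NLP}(t)$ for $t>0$: $$\min_{x,y\in\mathbb{R}^n} f(x)\quad\text{s.t.}\quad g(x)\le 0,\ h(x)=0,\ 0\le y\le e,\ -te\le x\circ y\le te,\ e^\top y\ge n-\kappa.$$ CC-MFCQ (Cardinality Constrained Mangasarian-Fromovitz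 Constraint Qualification): a point $(x^*,y^* )$ feasible for (P) satisfies CC-MFCQ if the gradients $\nabla g_i(x^* )$ $(i\in I_g(x^* ))$ and $\nabla h_i(x^* )$ $(i=1,\dots,p)$, $e_i$ $(i\in I_0(x^* ))$ are positively linearly independent, i.e. there are no multipliers $\lambda_i\ge 0$ $(i\in I_g(x^* ))$, $\mu_i\in\mathbb{R}$ $(i=1,\dots,p)$, $\gamma_i\in\mathbb{R}$ $(i\in I_0(x^* ))$ with $(\lambda,\mu,\gamma)\ne 0$ and $$\sum_{i\in I_g(x^* )}\lambda_i\nabla g_i(x^* )+\sum_{i=1}^p\mu_i\nabla h_i(x^* )+\sum_{i\in I_0(x^* )}\gamma_i e_i=0.$$ Standard MFCQ for $\mathrm{NLP}(t)$ at a feasible point $(x,y)$ is used in its positive-linear-independence form: writing all inequality constraints as $G_j(x,y)\le 0$ (namely $g_i(x)\le 0$, $-y_i\le 0$, $y_i-1\le 0$, $x_iy_i-t\le 0$, $-x_iy_i-t\le 0$, $n-\kappa-e^\top y\le 0$) and the equality constraints as $h_i(x)=0$, there is no nonzero vector of multipliers, nonnegative for the active inequality constraints and of arbitrary sign for the equality constraints, for which the corresponding linear combination of the gradients (with respect to $(x,y)\in\mathbb{R}^{2n}$) of the active inequality constraints and the equality constraints vanishes. *)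

theory Defs
  imports "HOL-Analysis.Analysis"
begin

text \<open>
  The maps \<open>g : \<real>\<^sup>n \<rightarrow> \<real>\<^sup>m\<close> and \<open>h : \<real>\<^sup>n \<rightarrow> \<real>\<^sup>p\<close> are given by their components \<open>g i\<close> for \<open>i < m\<close> and
  \<open>h i\<close> for \<open>i < p\<close>, so that \<open>m = 0\<close> and \<open>p = 0\<close> are allowed. The values \<open>g i\<close> for \<open>i \<ge> m\<close> and
  \<open>h i\<close> for \<open>i \<ge> p\<close> are never used.
\<close>

text \<open>Only meaningful where \<open>F\<close> is differentiable; the gradient is then unique.\<close>

definition grad :: "('a::real_inner \<Rightarrow> real) \<Rightarrow> 'a \<Rightarrow> 'a" where
  "grad F z = (THE D. GDERIV F z :> D)"

lemma grad_eqI: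
  assumes "GDERIV F z :> D"
  shows "grad F z = D"
  unfolding grad_def
proof (rule the_equality)
  fix E assume "GDERIV F z :> E"
  then have "(\<lambda>v. v \<bullet> E) = (\<lambda>v. v \<bullet> D)"
    using assms unfolding gderiv_def by (rule has_derivative_unique)
  then show "E = D"
    by (metis inner_commute vector_eq_rdot)
qed (rule assms)

lemma GDERIV_grad:
  fixes F :: "'a::euclidean_space \<Rightarrow> real"
  assumes "F differentiable at z"
  shows "GDERIV F z :> grad F z"
proof -
  obtain F' where F': "(F has_derivative F') (at z)"
    using assms unfolding differentiable_def by blast
  then have lin: "linear F'" by (rule has_derivative_linear)
  define D where "D = (\<Sum>b\<in>Basis. F' b *\<^sub>R b)"
  have "F' = (\<lambda>v. v \<bullet> D)"
  proof
    fix v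
    have "F' v = (\<Sum>b\<in>Basis. (v \<bullet> b) *\<^sub>R F' b)"
      using linear_sum[OF lin, of "\<lambda>b. (v \<bullet> b) *\<^sub>R b" Basis]
      by (simp add: euclidean_representation linear_scale[OF lin])
    then show "F' v = v \<bullet> D"
      by (simp add: D_def inner_sum_right mult.commute)
  qed
  with F' have "GDERIV F z :> D" by (simp add: gderiv_def)
  then show ?thesis by (simp add: grad_eqI)
qed

definition cont_diff :: "('a::euclidean_space \<Rightarrow> real) \<Rightarrow> bool" where
  "cont_diff F \<longleftrightarrow> (\<forall>z. F differentiable at z) \<and> continuous_on UNIV (grad F)"

definition P_feasible ::
  "nat \<Rightarrow> nat \<Rightarrow> (nat \<Rightarrow> real^'n \<Rightarrow> real) \<Rightarrow> (nat \<Rightarrow> real^'n \<Rightarrow> real) \<Rightarrow> nat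
    \<Rightarrow> (real^'n) \<times> (real^'n) \<Rightarrow> bool" where
  "P_feasible m p g h \<kappa> = (\<lambda>(x, y).
     (\<forall>i<m. g i x \<le> 0) \<and> (\<forall>i<p. h i x = 0) \<and>
     (\<forall>i. 0 \<le> y $ i \<and> y $ i \<le> 1) \<and>
     (\<forall>i. x $ i * y $ i = 0) \<and>
     (\<Sum>i\<in>UNIV. y $ i) \<ge> real CARD('n) - real \<kappa>)"

definition NLP_feasible ::
  "nat \<Rightarrow> nat \<Rightarrow> (nat \<Rightarrow> real^'n \<Rightarrow> real) \<Rightarrow> (nat \<Rightarrow> real^'n \<Rightarrow> real) \<Rightarrow> nat \<Rightarrow> real
    \<Rightarrow> (real^'n) \<times> (real^'n) \<Rightarrow> bool" where
  "NLP_feasible m p g h \<kappa> t = (\<lambda>(x, y).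
     (\<forall>i<m. g i x \<le> 0) \<and> (\<forall>i<p. h i x = 0) \<and>
     (\<forall>i. 0 \<le> y $ i \<and> y $ i \<le> 1) \<and>
     (\<forall>i. - t \<le> x $ i * y $ i \<and> x $ i * y $ i \<le> t) \<and>
     (\<Sum>i\<in>UNIV. y $ i) \<ge> real CARD('n) - real \<kappa>)"

definition CC_MFCQ ::
  "nat \<Rightarrow> nat \<Rightarrow> (nat \<Rightarrow> real^'n \<Rightarrow> real) \<Rightarrow> (nat \<Rightarrow> real^'n \<Rightarrow> real)
    \<Rightarrow> (real^'n) \<times> (real^'n) \<Rightarrow> bool" where
  "CC_MFCQ m p g h = (\<lambda>(x, y).
     let Ig = {i. i < m \<and> g i x = 0}; I0 = {i. x $ i = 0} in
     \<not> (\<exists>(l :: nat \<Rightarrow> real) (\<mu> :: nat \<Rightarrow> real) (\<gamma> :: 'n \<Rightarrow> real).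
          (\<forall>i\<in>Ig. 0 \<le> l i) \<and>
          ((\<exists>i\<in>Ig. l i \<noteq> 0) \<or> (\<exists>i<p. \<mu> i \<noteq> 0) \<or> (\<exists>i\<in>I0. \<gamma> i \<noteq> 0)) \<and>
          (\<Sum>i\<in>Ig. l i *\<^sub>R grad (g i) x) + (\<Sum>i<p. \<mu> i *\<^sub>R grad (h i) x)
            + (\<Sum>i\<in>I0. \<gamma> i *\<^sub>R axis i 1) = 0))"

text \<open>
  MFCQ, in its positive linear independence form, at a point \<open>z\<close> for a finite system
  \<open>G j z \<le> 0\<close> (\<open>j \<in> J\<close>), \<open>H k z = 0\<close> (\<open>k \<in> K\<close>); \<open>J\<close> and \<open>K\<close> have to be finite for the sums to
  make sense.
\<close>

definition MFCQ ::
  "'j set \<Rightarrow> ('j \<Rightarrow> 'a::euclidean_space \<Rightarrow> real) \<Rightarrow> 'k set \<Rightarrow> ('k \<Rightarrow> 'a \<Rightarrow> real) \<Rightarrow> 'a \<Rightarrow> bool" where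
  "MFCQ J G K H z \<longleftrightarrow>
     (let A = {j \<in> J. G j z = 0} in
      \<not> (\<exists>(l :: 'j \<Rightarrow> real) (\<mu> :: 'k \<Rightarrow> real).
           (\<forall>j\<in>A. 0 \<le> l j) \<and>
           ((\<exists>j\<in>A. l j \<noteq> 0) \<or> (\<exists>k\<in>K. \<mu> k \<noteq> 0)) \<and>
           (\<Sum>j\<in>A. l j *\<^sub>R grad (G j) z) + (\<Sum>k\<in>K. \<mu> k *\<^sub>R grad (H k) z) = 0))"

datatype 'n ineq = G_le nat | Y_lower 'n | Y_upper 'n | XY_upper 'n | XY_lower 'n | Card_le

definition NLP_ineqs :: "nat \<Rightarrow> 'n ineq set" where
  "NLP_ineqs m = G_le ` {..<m} \<union> range Y_lower \<union> range Y_upper \<union> range XY_upper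
     \<union> range XY_lower \<union> {Card_le}"

primrec NLP_G ::
  "(nat \<Rightarrow> real^'n \<Rightarrow> real) \<Rightarrow> nat \<Rightarrow> real \<Rightarrow> 'n ineq \<Rightarrow> (real^'n) \<times> (real^'n) \<Rightarrow> real" where
  "NLP_G g \<kappa> t (G_le i) = (\<lambda>(x, y). g i x)"
| "NLP_G g \<kappa> t (Y_lower i) = (\<lambda>(x, y). - y $ i)"
| "NLP_G g \<kappa> t (Y_upper i) = (\<lambda>(x, y). y $ i - 1)"
| "NLP_G g \<kappa> t (XY_upper i) = (\<lambda>(x, y). x $ i * y $ i - t)"
| "NLP_G g \<kappa> t (XY_lower i) = (\<lambda>(x, y). - (x $ i * y $ i) - t)"
| "NLP_G g \<kappa> t Card_le = (\<lambda>(x, y). real CARD('n) - real \<kappa> - (\<Sum>i\<in>UNIV. y $ i))"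

definition NLP_H ::
  "(nat \<Rightarrow> real^'n \<Rightarrow> real) \<Rightarrow> nat \<Rightarrow> (real^'n) \<times> (real^'n) \<Rightarrow> real" where
  "NLP_H h i = (\<lambda>(x, y). h i x)"

definition NLP_MFCQ ::
  "nat \<Rightarrow> nat \<Rightarrow> (nat \<Rightarrow> real^'n \<Rightarrow> real) \<Rightarrow> (nat \<Rightarrow> real^'n \<Rightarrow> real) \<Rightarrow> nat \<Rightarrow> real
    \<Rightarrow> (real^'n) \<times> (real^'n) \<Rightarrow> bool" where
  "NLP_MFCQ m p g h \<kappa> t = MFCQ (NLP_ineqs m) (NLP_G g \<kappa> t) {..<p} (NLP_H h)"

lemma finite_NLP_ineqs: "finite (NLP_ineqs m :: 'n::finite ineq set)"
  by (simp add: NLP_ineqs_def)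

lemma NLP_feasible_iff:
  "NLP_feasible m p g h \<kappa> t z \<longleftrightarrow>
     (\<forall>j\<in>NLP_ineqs m. NLP_G g \<kappa> t j z \<le> 0) \<and> (\<forall>i\<in>{..<p}. NLP_H h i z = 0)"
proof (cases z)
  case (Pair x y)
  have "- t \<le> a \<longleftrightarrow> - a - t \<le> 0" for a :: real by linarith
  then show ?thesis
    unfolding Pair NLP_feasible_def NLP_ineqs_def NLP_H_def
    by (simp add: ball_Un) blast
qed

end

theory Submission
  imports Defs
begin

text \<open>
  By compactness, CC-MFCQ gives a bound \<open>c * (|\<lambda>| + |\<mu>| + |\<gamma>|) \<le> norm (combination)\<close> that persists
  for \<open>x\<close> near \<open>x*\<close>. For a multiplier of \<open>NLP(t)\<close> let \<open>a i\<close> be the difference of the multipliers of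
  \<open>x i * y i \<le> t\<close> and \<open>- x i * y i \<le> t\<close>, and \<open>\<delta>\<close> that of the cardinality constraint. The
  \<open>x\<close>-part of stationarity bounds \<open>|\<gamma>|\<close>, where \<open>\<gamma> i = a i * y i\<close> for \<open>x* i = 0\<close>, by the same terms
  over \<open>x* i \<noteq> 0\<close>. If \<open>\<delta> = 0\<close>, the latter vanish and so do all multipliers. If \<open>\<delta> > 0\<close>, then all
  \<open>y i > 0\<close> and \<open>a i = \<delta> / x i\<close> wherever \<open>y i < 1\<close>. Since the cardinality constraint is active and
  \<open>\<kappa> > 0\<close>, some \<open>k\<close> has \<open>y* k > 0\<close> and \<open>y k < 1\<close>; there \<open>x k\<close> is near \<open>0\<close>, so \<open>\<gamma> k = \<delta> * y k / x k\<close>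
  is too large compared with the terms \<open>\<delta> * y j / x j\<close> for \<open>x* j \<noteq> 0\<close>, in which \<open>y j\<close> is near \<open>0\<close>.
\<close>

subsection \<open>Stability of positive linear independence\<close>

text \<open>Tychonoff's theorem. Coefficient vectors are functions on the whole index type, which
  may be infinite; pinning them to 0 outside \<open>K\<close> keeps every factor compact.\<close>

lemma compact_coefficient_box:
  "compact {u :: 'k \<Rightarrow> real. \<forall>i. u i \<in> (if i \<in> K then {-1..1} else {0})}"
proof -
  have "compactin (product_topology (\<lambda>i. euclidean) UNIV)
      (PiE UNIV (\<lambda>i::'k. if i \<in> K then {-1..1::real} else {0}))"
    unfolding compactin_PiE by auto
  then show ?thesis
    by (simp add: euclidean_product_topology PiE_UNIV_domain Pi_def)
qed

text \<open>The norm of the combination is continuous in the coefficients and, by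
  \<open>indep\<close>, nonzero on the compact set of admissible coefficients with absolute sum 1.
  Its minimum there serves as \<open>c\<close>, and homogeneity extends the bound to all admissible
  coefficients.\<close>

lemma pos_lin_indep_bound:
  fixes v :: "'k \<Rightarrow> 'a::real_normed_vector"
  assumes K: "finite K"
    and indep: "\<And>u. (\<forall>i\<in>K \<inter> P. 0 \<le> u i) \<Longrightarrow> (\<Sum>i\<in>K. u i *\<^sub>R v i) = 0 \<Longrightarrow> \<forall>i\<in>K. u i = 0"
  obtains c where "c > 0"
    "\<forall>u. (\<forall>i\<in>K \<inter> P. 0 \<le> u i) \<longrightarrow> c * (\<Sum>i\<in>K. \<bar>u i\<bar>) \<le> norm (\<Sum>i\<in>K. u i *\<^sub>R v i)"
proof -
  define B where "B = {u :: 'k \<Rightarrow> real. \<forall>i. u i \<in> (if i \<in> K then {-1..1} else {0})}"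
  define T where "T = (\<Inter>i\<in>K \<inter> P. {u :: 'k \<Rightarrow> real. 0 \<le> u i}) \<inter> {u. (\<Sum>i\<in>K. \<bar>u i\<bar>) = 1}"
  have "closed T"
    unfolding T_def
    by (intro closed_Int closed_INT ballI closed_Collect_le closed_Collect_eq continuous_intros
        continuous_on_product_coordinates)
  then have comp: "compact (B \<inter> T)"
    unfolding B_def by (intro compact_Int_closed compact_coefficient_box)
  obtain c where c: "c > 0" "\<And>u. u \<in> B \<inter> T \<Longrightarrow> c \<le> norm (\<Sum>i\<in>K. u i *\<^sub>R v i)"
  proof (cases "B \<inter> T = {}")
    case True
    \<comment> \<open>There is nothing to bound here (the case of empty \<open>K\<close>), so any
      positive constant will do.\<close>
    then show ?thesis using that[of 1] by auto
  next
    case False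
    have "continuous_on (B \<inter> T) (\<lambda>u. norm (\<Sum>i\<in>K. u i *\<^sub>R v i))"
      by (intro continuous_intros continuous_on_product_coordinates[THEN continuous_on_subset]) auto
    from continuous_attains_inf[OF comp False this]
    obtain u0 where u0: "u0 \<in> B \<inter> T"
      "\<And>u. u \<in> B \<inter> T \<Longrightarrow> norm (\<Sum>i\<in>K. u0 i *\<^sub>R v i) \<le> norm (\<Sum>i\<in>K. u i *\<^sub>R v i)"
      by blast
    have "(\<Sum>i\<in>K. u0 i *\<^sub>R v i) \<noteq> 0"
    proof
      assume "(\<Sum>i\<in>K. u0 i *\<^sub>R v i) = 0"
      then have "\<forall>i\<in>K. u0 i = 0" using indep u0(1) by (auto simp: T_def)
      then show False using u0(1) by (auto simp: T_def)
    qed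
    then show ?thesis using that u0(2) by (metis zero_less_norm_iff)
  qed
  show ?thesis
  proof (rule that[OF c(1)], intro allI impI)
    fix u :: "'k \<Rightarrow> real" assume u: "\<forall>i\<in>K \<inter> P. 0 \<le> u i"
    define s where "s = (\<Sum>i\<in>K. \<bar>u i\<bar>)"
    show "c * (\<Sum>i\<in>K. \<bar>u i\<bar>) \<le> norm (\<Sum>i\<in>K. u i *\<^sub>R v i)"
    proof (cases "s = 0")
      case True
      then show ?thesis by (simp add: s_def)
    next
      case False
      then have s: "s > 0" by (simp add: s_def sum_nonneg less_le)
      \<comment> \<open>Normalization of \<open>u\<close> to absolute sum 1, reset to 0 outside
        \<open>K\<close> so as to lie in \<open>B\<close>.\<close>
      define w where "w = (\<lambda>i. if i \<in> K then u i / s else 0)"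
      have le: "\<bar>u i\<bar> \<le> s" if "i \<in> K" for i
        unfolding s_def using that K by (intro member_le_sum) auto
      have "w \<in> B"
        using s by (auto simp: B_def w_def field_simps dest!: le)
      moreover have "(\<Sum>i\<in>K. \<bar>w i\<bar>) = 1"
        using s by (simp add: w_def s_def flip: sum_divide_distrib)
      then have "w \<in> T" using u s by (auto simp: T_def w_def)
      ultimately have "c \<le> norm (\<Sum>i\<in>K. w i *\<^sub>R v i)" using c(2) by blast
      also have "(\<Sum>i\<in>K. w i *\<^sub>R v i) = (1 / s) *\<^sub>R (\<Sum>i\<in>K. u i *\<^sub>R v i)"
        by (simp add: w_def scaleR_sum_right)
      finally show ?thesis using s by (simp add: s_def[symmetric] field_simps)
    qed
  qed
qed

text \<open>Moving every vector by less than half of the constant valid at \<open>z\<close> changes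
  the combination by at most that half times the absolute sum of the coefficients. The other half
  therefore survives, uniformly in \<open>u\<close>.\<close>

lemma pos_lin_indep_bound_nhds:
  fixes V :: "'k \<Rightarrow> 'b::topological_space \<Rightarrow> 'a::real_normed_vector"
  assumes K: "finite K"
    and indep: "\<And>u. (\<forall>i\<in>K \<inter> P. 0 \<le> u i) \<Longrightarrow> (\<Sum>i\<in>K. u i *\<^sub>R V i z) = 0 \<Longrightarrow> \<forall>i\<in>K. u i = 0"
    and cont: "\<And>i. i \<in> K \<Longrightarrow> (V i \<longlongrightarrow> V i z) (nhds z)"
  obtains c where "c > 0"
    "\<forall>\<^sub>F x in nhds z. \<forall>u. (\<forall>i\<in>K \<inter> P. 0 \<le> u i) \<longrightarrow>
        c * (\<Sum>i\<in>K. \<bar>u i\<bar>) \<le> norm (\<Sum>i\<in>K. u i *\<^sub>R V i x)"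
proof -
  obtain c where c: "c > 0"
    "\<forall>u. (\<forall>i\<in>K \<inter> P. 0 \<le> u i) \<longrightarrow> c * (\<Sum>i\<in>K. \<bar>u i\<bar>) \<le> norm (\<Sum>i\<in>K. u i *\<^sub>R V i z)"
    by (rule pos_lin_indep_bound[where P = P and v = "\<lambda>i. V i z", OF K indep])
  have "\<forall>\<^sub>F x in nhds z. \<forall>i\<in>K. dist (V i x) (V i z) < c / 2"
    using K c(1) cont by (intro eventually_ball_finite ballI tendstoD) auto
  then have "\<forall>\<^sub>F x in nhds z. \<forall>u. (\<forall>i\<in>K \<inter> P. 0 \<le> u i) \<longrightarrow>
        (c / 2) * (\<Sum>i\<in>K. \<bar>u i\<bar>) \<le> norm (\<Sum>i\<in>K. u i *\<^sub>R V i x)"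
  proof (rule eventually_mono, intro allI impI)
    fix x and u :: "'k \<Rightarrow> real"
    assume near: "\<forall>i\<in>K. dist (V i x) (V i z) < c / 2" and u: "\<forall>i\<in>K \<inter> P. 0 \<le> u i"
    have "norm ((\<Sum>i\<in>K. u i *\<^sub>R V i z) - (\<Sum>i\<in>K. u i *\<^sub>R V i x))
        = norm (\<Sum>i\<in>K. u i *\<^sub>R (V i z - V i x))"
      by (simp add: sum_subtractf scaleR_diff_right)
    also have "\<dots> \<le> (\<Sum>i\<in>K. \<bar>u i\<bar> * (c / 2))"
    proof (rule sum_norm_le)
      fix i assume "i \<in> K"
      then have "norm (V i z - V i x) \<le> c / 2"
        using near by (simp add: dist_norm norm_minus_commute less_imp_le)
      then show "norm (u i *\<^sub>R (V i z - V i x)) \<le> \<bar>u i\<bar> * (c / 2)"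
        unfolding norm_scaleR by (rule mult_left_mono) simp
    qed
    also have "\<dots> = (c / 2) * (\<Sum>i\<in>K. \<bar>u i\<bar>)"
      by (simp add: sum_distrib_left mult.commute)
    finally have "norm (\<Sum>i\<in>K. u i *\<^sub>R V i z) - norm (\<Sum>i\<in>K. u i *\<^sub>R V i x)
        \<le> (c / 2) * (\<Sum>i\<in>K. \<bar>u i\<bar>)"
      using norm_triangle_ineq2 order_trans by blast
    then show "(c / 2) * (\<Sum>i\<in>K. \<bar>u i\<bar>) \<le> norm (\<Sum>i\<in>K. u i *\<^sub>R V i x)"
      using c(2)[THEN spec, THEN mp, OF u] by simp
  qed
  then show ?thesis using that[of "c / 2"] c(1) by simp
qed

subsection \<open>The multiplier system of the regularized problem\<close>

text \<open>
  Here \<open>R\<close> collects the absolute values of the multipliers of \<open>g\<close> and \<open>h\<close>, and \<open>vl\<close>, \<open>vu\<close>, \<open>\<delta>\<close> belong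
  to \<open>0 \<le> y\<close>, \<open>y \<le> 1\<close> and the cardinality constraint.
\<close>

lemma NLP_multipliers_vanish:
  fixes x y xs ys a vl vu :: "'n::finite \<Rightarrow> real" and \<kappa> :: nat
  assumes c: "c > 0" and R: "R \<ge> 0" and \<delta>: "\<delta> \<ge> 0" and \<kappa>: "\<kappa> > 0"
    and indep: "c * (R + (\<Sum>i | xs i = 0. \<bar>a i * y i\<bar>)) \<le> (\<Sum>j | xs j \<noteq> 0. \<bar>a j * y j\<bar>)"
    and stat: "\<And>i. vu i - vl i + a i * x i - \<delta> = 0"
    and vl: "\<And>i. 0 \<le> vl i" "\<And>i. vl i \<noteq> 0 \<Longrightarrow> y i = 0"
    and vu: "\<And>i. 0 \<le> vu i" "\<And>i. vu i \<noteq> 0 \<Longrightarrow> y i = 1"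
    and a: "\<And>i. a i \<noteq> 0 \<Longrightarrow> x i * y i \<noteq> 0"
    and card: "\<delta> \<noteq> 0 \<Longrightarrow> sum y UNIV = real CARD('n) - real \<kappa>"
    and y: "\<And>i. 0 \<le> y i" "\<And>i. y i \<le> 1"
    and ys: "\<And>i. ys i \<le> 1" "\<And>i. 0 \<le> ys i" "\<And>i. xs i * ys i = 0"
      "sum ys UNIV \<ge> real CARD('n) - real \<kappa>"
    and near: "\<And>i. xs i \<noteq> 0 \<Longrightarrow> x i \<noteq> 0" "\<And>i. xs i \<noteq> 0 \<Longrightarrow> y i < 1"
    and dom: "\<And>i. ys i > 0 \<Longrightarrow> \<bar>x i\<bar> * (\<Sum>j | xs j \<noteq> 0. \<bar>y j / x j\<bar>) < c * y i"
  shows "R = 0 \<and> \<delta> = 0 \<and> (\<forall>i. a i = 0 \<and> vl i = 0 \<and> vu i = 0)"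
proof -
  have "\<delta> = 0"
  proof (rule ccontr)
    assume "\<delta> \<noteq> 0"
    with \<delta> have \<delta>0: "\<delta> > 0" by simp
    \<comment> \<open>At \<open>y i = 0\<close> both \<open>a i\<close> and \<open>vu i\<close>
      vanish, and stationarity would give \<open>vl i = - \<delta>\<close>, which is
      negative.\<close>
    have ypos: "y i > 0" for i
    proof (rule ccontr)
      assume "\<not> y i > 0"
      then have "y i = 0" using y(1)[of i] by simp
      then have "a i = 0" "vu i = 0" using a[of i] vu(2)[of i] by auto
      then show False using stat[of i] vl(1)[of i] \<delta>0 by simp
    qed
    then have vl0: "vl i = 0" for i using vl(2)[of i] by (metis less_irrefl)
    have ax: "a i * x i = \<delta>" if "y i < 1" for i
      using stat[of i] vl0[of i] vu(2)[of i] that by force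
    \<comment> \<open>Otherwise \<open>ys i \<le> y i\<close> everywhere, and comparing the sums
      forces equality. Then \<open>y\<close> is positive throughout, hence equal to 1 throughout, so
      its sum is \<open>CARD('n)\<close> and not \<open>CARD('n) - \<kappa>\<close>.\<close>
    have "\<exists>i. ys i > 0 \<and> y i < 1"
    proof (rule ccontr)
      assume "\<not> ?thesis"
      then have le: "ys i \<le> y i" for i
        using y(1)[of i] y(2)[of i] ys(1)[of i] ys(2)[of i] by (metis less_le order.trans)
      have eq: "ys i = y i" for i
      proof (rule ccontr)
        assume "ys i \<noteq> y i"
        then have "ys i < y i" using le[of i] by simp
        then have "sum ys UNIV < sum y UNIV" using le by (intro sum_strict_mono_ex1) auto
        then show False using card[OF \<open>\<delta> \<noteq> 0\<close>] ys(4) by simp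
      qed
      then have "y i = 1" for i
        using \<open>\<not> (\<exists>i. ys i > 0 \<and> y i < 1)\<close> ypos[of i] y(2)[of i] by (metis less_le)
      then show False using card[OF \<open>\<delta> \<noteq> 0\<close>] \<kappa> by simp
    qed
    then obtain k where k: "ys k > 0" "y k < 1" by blast
    then have xsk: "xs k = 0" using ys(3)[of k] by simp
    have axk: "a k * x k = \<delta>" using ax k(2) by blast
    then have xk: "x k \<noteq> 0" using \<delta>0 by auto
    have ak: "\<bar>x k\<bar> * \<bar>a k * y k\<bar> = \<delta> * y k"
    proof -
      have "\<bar>x k\<bar> * \<bar>a k * y k\<bar> = \<bar>a k * x k\<bar> * \<bar>y k\<bar>" by (simp add: abs_mult)
      then show ?thesis using axk \<delta>0 ypos[of k] by simp
    qed
    have aj: "\<bar>a j * y j\<bar> = \<delta> * \<bar>y j / x j\<bar>" if "xs j \<noteq> 0" for j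
    proof -
      have "a j = \<delta> / x j" using ax[OF near(2)[OF that]] near(1)[OF that] by (simp add: field_simps)
      then show ?thesis using \<delta>0 by (simp add: abs_mult)
    qed
    have "\<bar>a k * y k\<bar> \<le> (\<Sum>i | xs i = 0. \<bar>a i * y i\<bar>)"
      using xsk by (intro member_le_sum[where f = "\<lambda>i. \<bar>a i * y i\<bar>"]) auto
    then have "c * \<bar>a k * y k\<bar> \<le> c * (R + (\<Sum>i | xs i = 0. \<bar>a i * y i\<bar>))"
      using c R by (intro mult_left_mono) auto
    also have "\<dots> \<le> (\<Sum>j | xs j \<noteq> 0. \<bar>a j * y j\<bar>)" by (rule indep)
    also have "\<dots> = \<delta> * (\<Sum>j | xs j \<noteq> 0. \<bar>y j / x j\<bar>)"
      unfolding sum_distrib_left by (intro sum.cong refl) (simp add: aj)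
    \<comment> \<open>Multiplying by \<open>\<bar>x k\<bar>\<close> turns the left side into
      \<open>c * \<delta> * y k\<close>, so that after cancelling \<open>\<delta>\<close> the
      inequality contradicts \<open>dom\<close>.\<close>
    finally have "\<bar>x k\<bar> * (c * \<bar>a k * y k\<bar>) \<le> \<bar>x k\<bar> * (\<delta> * (\<Sum>j | xs j \<noteq> 0. \<bar>y j / x j\<bar>))"
      by (intro mult_left_mono) auto
    then have "c * (\<bar>x k\<bar> * \<bar>a k * y k\<bar>) \<le> \<delta> * (\<bar>x k\<bar> * (\<Sum>j | xs j \<noteq> 0. \<bar>y j / x j\<bar>))"
      by (simp only: mult.left_commute)
    then have "\<delta> * (c * y k) \<le> \<delta> * (\<bar>x k\<bar> * (\<Sum>j | xs j \<noteq> 0. \<bar>y j / x j\<bar>))"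
      unfolding ak by (simp only: mult.left_commute)
    then show False using dom[OF k(1)] \<delta>0 by simp
  qed
  \<comment> \<open>The disjunction serves two uses: first the indices with
    \<open>xs i \<noteq> 0\<close>, which makes the right side of \<open>indep\<close> vanish; then
    all indices, once \<open>a i = 0\<close> is known everywhere.\<close>
  have ax0: "a i = 0 \<and> vl i = 0 \<and> vu i = 0" if "x i \<noteq> 0 \<and> y i < 1 \<or> a i = 0" for i
  proof (cases "y i = 0")
    case True
    then have "a i = 0" "vu i = 0" using a[of i] vu(2)[of i] by auto
    then show ?thesis using stat[of i] \<open>\<delta> = 0\<close> by simp
  next
    case False
    then have "vl i = 0" using vl(2) by blast
    moreover have "vu i = 0" if "x i \<noteq> 0 \<and> y i < 1" using that vu(2)[of i] by auto
    ultimately show ?thesis using that stat[of i] \<open>\<delta> = 0\<close> by auto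
  qed
  have "(\<Sum>j | xs j \<noteq> 0. \<bar>a j * y j\<bar>) = 0"
    using ax0 near by (intro sum.neutral) simp
  then have "c * (R + (\<Sum>i | xs i = 0. \<bar>a i * y i\<bar>)) \<le> 0" using indep by simp
  then have le0: "R + (\<Sum>i | xs i = 0. \<bar>a i * y i\<bar>) \<le> 0" using c by (simp add: mult_le_0_iff)
  moreover have nn: "(\<Sum>i | xs i = 0. \<bar>a i * y i\<bar>) \<ge> 0" by (intro sum_nonneg) simp
  ultimately have "R = 0" and sum0: "(\<Sum>i | xs i = 0. \<bar>a i * y i\<bar>) = 0" using R by linarith+
  have "a i = 0" for i
  proof (cases "xs i = 0")
    case True
    then have "a i * y i = 0" using sum0 by (simp add: sum_nonneg_eq_0_iff)
    then show ?thesis using a[of i] by auto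
  next
    case False
    then show ?thesis using ax0 near by blast
  qed
  then show ?thesis using ax0 \<open>R = 0\<close> \<open>\<delta> = 0\<close> by blast
qed

section \<open>Gradients of the constraints of the regularized problem\<close>

lemma sum_NLP_ineqs:
  fixes F :: "'n::finite ineq \<Rightarrow> 'b::comm_monoid_add"
  shows "sum F (NLP_ineqs m) = (\<Sum>i<m. F (G_le i)) + (\<Sum>i\<in>UNIV. F (Y_lower i))
    + (\<Sum>i\<in>UNIV. F (Y_upper i)) + (\<Sum>i\<in>UNIV. F (XY_upper i)) + (\<Sum>i\<in>UNIV. F (XY_lower i))
    + F Card_le"
  unfolding NLP_ineqs_def
  by (subst sum.union_disjoint; (auto; fail)?)+ (simp add: sum.reindex inj_on_def)

lemma grad_fst:
  fixes F :: "real^'n \<Rightarrow> real"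
  assumes "F differentiable at x"
  shows "grad (\<lambda>(x, y :: real^'n). F x) (x, y) = (grad F x, 0)"
proof (rule grad_eqI)
  have "(F has_derivative (\<lambda>v. v \<bullet> grad F x)) (at (fst (x, y)))"
    using GDERIV_grad[OF assms] by (simp add: gderiv_def)
  from has_derivative_compose[OF has_derivative_fst[OF has_derivative_ident] this]
  show "GDERIV (\<lambda>(x, y :: real^'n). F x) (x, y) :> (grad F x, 0)"
    by (simp add: gderiv_def case_prod_unfold inner_prod_def)
qed

lemma GDERIV_vec_nth:
  fixes z :: "(real^'n) \<times> (real^'n)"
  shows "GDERIV (\<lambda>z. fst z $ i) z :> (axis i 1, 0)"
    and "GDERIV (\<lambda>z. snd z $ i) z :> (0, axis i 1)"
proof -
  have "((\<lambda>z :: (real^'n) \<times> (real^'n). fst z $ i) has_derivative (\<lambda>h. fst h $ i)) (at z)"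
    "((\<lambda>z :: (real^'n) \<times> (real^'n). snd z $ i) has_derivative (\<lambda>h. snd h $ i)) (at z)"
    by (intro bounded_linear_imp_has_derivative bounded_linear_compose[OF bounded_linear_vec_nth]
        bounded_linear_fst bounded_linear_snd)+
  then show "GDERIV (\<lambda>z. fst z $ i) z :> (axis i 1, 0)" "GDERIV (\<lambda>z. snd z $ i) z :> (0, axis i 1)"
    by (simp_all add: gderiv_def inner_prod_def inner_axis)
qed

lemma grad_NLP_G:
  fixes x y :: "real^'n"
  shows "grad (NLP_G g \<kappa> t (Y_lower i)) (x, y) = (0, - axis i 1)"
    and "grad (NLP_G g \<kappa> t (Y_upper i)) (x, y) = (0, axis i 1)"
    and "grad (NLP_G g \<kappa> t (XY_upper i)) (x, y) = (axis i (y $ i), axis i (x $ i))"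
    and "grad (NLP_G g \<kappa> t (XY_lower i)) (x, y) = (- axis i (y $ i), - axis i (x $ i))"
    and "grad (NLP_G g \<kappa> t Card_le) (x, y) = (0, - (\<Sum>i\<in>UNIV. axis i 1))"
proof -
  note D = GDERIV_vec_nth[of _ "(x, y)"]
  have ax: "c *\<^sub>R axis i 1 = (axis i c :: real^'n)" for c :: real
    by (simp add: axis_def vec_eq_iff)
  have xy: "GDERIV (\<lambda>z. fst z $ i * snd z $ i) (x, y) :> (axis i (y $ i), axis i (x $ i))"
    using GDERIV_mult[OF D(1)[of i] D(2)[of i]] by (simp add: ax)
  show "grad (NLP_G g \<kappa> t (Y_lower i)) (x, y) = (0, - axis i 1)"
    using GDERIV_minus[OF D(2)] by (intro grad_eqI) (simp add: case_prod_unfold)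
  show "grad (NLP_G g \<kappa> t (Y_upper i)) (x, y) = (0, axis i 1)"
    using GDERIV_diff[OF D(2) GDERIV_const] by (intro grad_eqI) (simp add: case_prod_unfold)
  show "grad (NLP_G g \<kappa> t (XY_upper i)) (x, y) = (axis i (y $ i), axis i (x $ i))"
    using GDERIV_diff[OF xy GDERIV_const] by (intro grad_eqI) (simp add: case_prod_unfold)
  show "grad (NLP_G g \<kappa> t (XY_lower i)) (x, y) = (- axis i (y $ i), - axis i (x $ i))"
    using GDERIV_diff[OF GDERIV_minus[OF xy] GDERIV_const]
    by (intro grad_eqI) (simp add: case_prod_unfold)
  have "GDERIV (\<lambda>z. \<Sum>i\<in>UNIV. snd z $ i) (x, y) :> (\<Sum>i\<in>UNIV. (0, axis i 1))"
    using D(2) unfolding gderiv_def inner_sum_right by (intro has_derivative_sum) auto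
  from GDERIV_diff[OF GDERIV_const this]
  show "grad (NLP_G g \<kappa> t Card_le) (x, y) = (0, - (\<Sum>i\<in>UNIV. axis i 1))"
    by (intro grad_eqI) (simp add: case_prod_unfold sum_prod)
qed

section \<open>Consequences of CC-MFCQ and of stationarity for the multipliers\<close>

text \<open>The three families of gradients are merged into one over a disjoint sum of index sets,
  with the sign condition on the first summand only. The index sets stay frozen at \<open>xs\<close>
  while the gradients are taken at the moving point \<open>x\<close>.\<close>

lemma CC_MFCQ_bound_nhds:
  fixes g h :: "nat \<Rightarrow> real^'n \<Rightarrow> real"
  assumes g: "\<And>i. i < m \<Longrightarrow> cont_diff (g i)"
    and h: "\<And>i. i < p \<Longrightarrow> cont_diff (h i)"
    and cq: "CC_MFCQ m p g h (xs, ys)"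
  obtains c where "c > 0"
    "\<forall>\<^sub>F x in nhds xs. \<forall>l \<mu> (\<gamma> :: 'n \<Rightarrow> real). (\<forall>i\<in>{i. i < m \<and> g i xs = 0}. 0 \<le> l i) \<longrightarrow>
        c * ((\<Sum>i | i < m \<and> g i xs = 0. \<bar>l i\<bar>) + (\<Sum>i<p. \<bar>\<mu> i\<bar>) + (\<Sum>i | xs $ i = 0. \<bar>\<gamma> i\<bar>))
        \<le> norm ((\<Sum>i | i < m \<and> g i xs = 0. l i *\<^sub>R grad (g i) x) + (\<Sum>i<p. \<mu> i *\<^sub>R grad (h i) x)
             + (\<Sum>i | xs $ i = 0. \<gamma> i *\<^sub>R axis i 1))"
proof -
  define Ig where "Ig = {i. i < m \<and> g i xs = 0}"
  define I0 where "I0 = {i. xs $ i = 0}"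
  define K where "K = Ig <+> ({..<p} <+> I0)"
  define V :: "nat + nat + 'n \<Rightarrow> real^'n \<Rightarrow> real^'n" where
    "V k x = (case k of Inl i \<Rightarrow> grad (g i) x
        | Inr r \<Rightarrow> (case r of Inl i \<Rightarrow> grad (h i) x | Inr i \<Rightarrow> axis i 1))" for k x
  have fin: "finite Ig" "finite I0" "finite {..<p}" "finite ({..<p} <+> I0)" "finite K"
    by (auto simp: Ig_def K_def intro!: finite_Plus)
  have sumK: "(\<Sum>k\<in>K. F k) = (\<Sum>i\<in>Ig. F (Inl i)) + (\<Sum>i<p. F (Inr (Inl i)))
      + (\<Sum>i\<in>I0. F (Inr (Inr i)))" for F :: "_ \<Rightarrow> 'b::comm_monoid_add"
    using fin by (simp add: K_def sum.Plus comp_def add.assoc)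
  have cq': "(\<forall>i\<in>Ig. l i = 0) \<and> (\<forall>i<p. \<mu> i = 0) \<and> (\<forall>i\<in>I0. \<gamma> i = 0)"
    if "\<forall>i\<in>Ig. 0 \<le> l i"
      "(\<Sum>i\<in>Ig. l i *\<^sub>R grad (g i) xs) + (\<Sum>i<p. \<mu> i *\<^sub>R grad (h i) xs)
        + (\<Sum>i\<in>I0. \<gamma> i *\<^sub>R axis i 1) = 0" for l \<mu> and \<gamma> :: "'n \<Rightarrow> real"
    using cq that unfolding CC_MFCQ_def Let_def prod.case Ig_def[symmetric] I0_def[symmetric]
    by blast
  have indep: "\<forall>k\<in>K. u k = 0"
    if "\<forall>k\<in>K \<inter> range Inl. 0 \<le> u k" "(\<Sum>k\<in>K. u k *\<^sub>R V k xs) = 0" for u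
  proof -
    have "\<forall>i\<in>Ig. 0 \<le> u (Inl i)" using that(1) by (auto simp: K_def)
    moreover have "(\<Sum>i\<in>Ig. u (Inl i) *\<^sub>R grad (g i) xs) + (\<Sum>i<p. u (Inr (Inl i)) *\<^sub>R grad (h i) xs)
        + (\<Sum>i\<in>I0. u (Inr (Inr i)) *\<^sub>R axis i 1) = 0"
      using that(2) by (simp add: sumK V_def)
    ultimately have "(\<forall>i\<in>Ig. u (Inl i) = 0) \<and> (\<forall>i<p. u (Inr (Inl i)) = 0)
        \<and> (\<forall>i\<in>I0. u (Inr (Inr i)) = 0)"
      by (rule cq')
    then show ?thesis by (auto simp: K_def)
  qed
  have tend: "(grad F \<longlongrightarrow> grad F xs) (nhds xs)" if "cont_diff F" for F
    using that continuous_on_eq_continuous_at[of UNIV "grad F"]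
    by (simp add: cont_diff_def isCont_def tendsto_at_iff_tendsto_nhds)
  have cont: "(V k \<longlongrightarrow> V k xs) (nhds xs)" if "k \<in> K" for k
  proof -
    have "V k = (case k of Inl i \<Rightarrow> grad (g i) | Inr (Inl i) \<Rightarrow> grad (h i) | Inr (Inr i) \<Rightarrow> (\<lambda>x. axis i 1))"
      by (auto simp: V_def fun_eq_iff split: sum.split)
    then show ?thesis using that g h by (auto simp: K_def Ig_def intro!: tend)
  qed
  obtain c where c: "c > 0" and ev: "\<forall>\<^sub>F x in nhds xs. \<forall>u. (\<forall>k\<in>K \<inter> range Inl. 0 \<le> u k) \<longrightarrow>
        c * (\<Sum>k\<in>K. \<bar>u k\<bar>) \<le> norm (\<Sum>k\<in>K. u k *\<^sub>R V k x)"
    by (rule pos_lin_indep_bound_nhds[where P = "range Inl" and V = V and z = xs,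
          OF fin(5) indep cont])
  show ?thesis
  proof (rule that[OF c], rule eventually_mono[OF ev], fold Ig_def I0_def, intro allI impI)
    fix x and l \<mu> :: "nat \<Rightarrow> real" and \<gamma> :: "'n \<Rightarrow> real"
    assume H: "\<forall>u. (\<forall>k\<in>K \<inter> range Inl. 0 \<le> u k) \<longrightarrow>
        c * (\<Sum>k\<in>K. \<bar>u k\<bar>) \<le> norm (\<Sum>k\<in>K. u k *\<^sub>R V k x)" and l: "\<forall>i\<in>Ig. 0 \<le> l i"
    let ?u = "case_sum l (case_sum \<mu> \<gamma>)"
    have "\<forall>k\<in>K \<inter> range Inl. 0 \<le> ?u k" using l by (auto simp: K_def)
    then have "c * (\<Sum>k\<in>K. \<bar>?u k\<bar>) \<le> norm (\<Sum>k\<in>K. ?u k *\<^sub>R V k x)" using H by blast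
    then show "c * ((\<Sum>i\<in>Ig. \<bar>l i\<bar>) + (\<Sum>i<p. \<bar>\<mu> i\<bar>) + (\<Sum>i\<in>I0. \<bar>\<gamma> i\<bar>))
        \<le> norm ((\<Sum>i\<in>Ig. l i *\<^sub>R grad (g i) x) + (\<Sum>i<p. \<mu> i *\<^sub>R grad (h i) x)
             + (\<Sum>i\<in>I0. \<gamma> i *\<^sub>R axis i 1))"
      by (simp add: sumK V_def)
  qed
qed

text \<open>The two claims are the \<open>x\<close>-part and the \<open>y\<close>-part of the
  vanishing combination. Only the product constraints contribute to both, and their two multipliers
  enter solely through the difference \<open>a\<close>. The sum runs over all constraints, so
  \<open>L\<close> is meant to be 0 on inactive ones.\<close>

lemma NLP_stationarity:
  fixes x y :: "real^'n" and L :: "'n ineq \<Rightarrow> real"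
  assumes g: "\<And>i. i < m \<Longrightarrow> g i differentiable at x"
    and h: "\<And>i. i < p \<Longrightarrow> h i differentiable at x"
    and eq: "(\<Sum>j\<in>NLP_ineqs m. L j *\<^sub>R grad (NLP_G g \<kappa> t j) (x, y))
      + (\<Sum>k<p. \<mu> k *\<^sub>R grad (NLP_H h k) (x, y)) = 0"
  defines "a \<equiv> \<lambda>i. L (XY_upper i) - L (XY_lower i)"
  shows "(\<Sum>i<m. L (G_le i) *\<^sub>R grad (g i) x) + (\<Sum>k<p. \<mu> k *\<^sub>R grad (h k) x)
      + (\<Sum>i\<in>UNIV. (a i * y $ i) *\<^sub>R axis i 1) = 0"
    and "L (Y_upper k) - L (Y_lower k) + a k * x $ k - L Card_le = 0"
proof -
  have G: "(\<Sum>i<m. L (G_le i) *\<^sub>R grad (NLP_G g \<kappa> t (G_le i)) (x, y))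
      = (\<Sum>i<m. (L (G_le i) *\<^sub>R grad (g i) x, 0))"
    using g by (intro sum.cong) (auto simp: grad_fst)
  have H: "(\<Sum>k<p. \<mu> k *\<^sub>R grad (NLP_H h k) (x, y)) = (\<Sum>k<p. (\<mu> k *\<^sub>R grad (h k) x, 0))"
    using h by (intro sum.cong) (auto simp: grad_fst NLP_H_def)
  have ax: "axis i c = c *\<^sub>R (axis i 1 :: real^'n)" for i :: 'n and c :: real
    by (simp add: axis_def vec_eq_iff)
  have "fst ((\<Sum>j\<in>NLP_ineqs m. L j *\<^sub>R grad (NLP_G g \<kappa> t j) (x, y))
      + (\<Sum>k<p. \<mu> k *\<^sub>R grad (NLP_H h k) (x, y))) = 0"
    using eq by simp
  then show "(\<Sum>i<m. L (G_le i) *\<^sub>R grad (g i) x) + (\<Sum>k<p. \<mu> k *\<^sub>R grad (h k) x)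
      + (\<Sum>i\<in>UNIV. (a i * y $ i) *\<^sub>R axis i 1) = 0"
    unfolding sum_NLP_ineqs G H grad_NLP_G
    by (simp add: fst_sum a_def ax[of _ "y $ _"] left_diff_distrib scaleR_left_diff_distrib
        sum_subtractf sum_negf algebra_simps)
  have "snd ((\<Sum>j\<in>NLP_ineqs m. L j *\<^sub>R grad (NLP_G g \<kappa> t j) (x, y))
      + (\<Sum>k<p. \<mu> k *\<^sub>R grad (NLP_H h k) (x, y))) $ k = 0"
    using eq by simp
  then show "L (Y_upper k) - L (Y_lower k) + a k * x $ k - L Card_le = 0"
    unfolding sum_NLP_ineqs G H grad_NLP_G
    by (simp add: snd_sum a_def axis_def if_distrib sum.delta' algebra_simps sum_negf cong: if_cong)
qed

section \<open>Choice of the neighborhood and vanishing of all multipliers\<close>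

theorem theorem3p2:
  fixes m p \<kappa> :: nat
    and f :: "real^'n \<Rightarrow> real"
    and g h :: "nat \<Rightarrow> real^'n \<Rightarrow> real"
    and xs ys :: "real^'n"
  assumes "cont_diff f"
    and "\<And>i. i < m \<Longrightarrow> cont_diff (g i)"
    and "\<And>i. i < p \<Longrightarrow> cont_diff (h i)"
    and "\<kappa> > 0"
    and "P_feasible m p g h \<kappa> (xs, ys)"
    and "CC_MFCQ m p g h (xs, ys)"
  shows "\<exists>U. open U \<and> (xs, ys) \<in> U \<and>
           (\<forall>t>0. \<forall>x y. (x, y) \<in> U \<longrightarrow> NLP_feasible m p g h \<kappa> t (x, y)
              \<longrightarrow> NLP_MFCQ m p g h \<kappa> t (x, y))"
proof -
  define Ig where "Ig = {i. i < m \<and> g i xs = 0}"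
  define B where "B c x \<longleftrightarrow> (\<forall>l \<mu> (\<gamma> :: 'n \<Rightarrow> real). (\<forall>i\<in>Ig. 0 \<le> l i) \<longrightarrow>
        c * ((\<Sum>i\<in>Ig. \<bar>l i\<bar>) + (\<Sum>i<p. \<bar>\<mu> i\<bar>) + (\<Sum>i | xs $ i = 0. \<bar>\<gamma> i\<bar>))
        \<le> norm ((\<Sum>i\<in>Ig. l i *\<^sub>R grad (g i) x) + (\<Sum>i<p. \<mu> i *\<^sub>R grad (h i) x)
             + (\<Sum>i | xs $ i = 0. \<gamma> i *\<^sub>R axis i 1)))" for c x
  obtain c where c: "c > 0" and B: "\<forall>\<^sub>F x in nhds xs. B c x"
    using CC_MFCQ_bound_nhds[OF assms(2,3,6)] unfolding B_def Ig_def by blast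
  have ys: "\<And>i. 0 \<le> ys $ i" "\<And>i. ys $ i \<le> 1" "\<And>i. xs $ i * ys $ i = 0"
    "(\<Sum>i\<in>UNIV. ys $ i) \<ge> real CARD('n) - real \<kappa>"
    using assms(5) by (auto simp: P_feasible_def)
  \<comment> \<open>Everything required of a nearby point, independently of \<open>t\<close>: the
    bound from CC-MFCQ, no newly active \<open>g i\<close>, and the hypotheses \<open>near\<close>
    and \<open>dom\<close> of \<open>NLP_multipliers_vanish\<close>.\<close>
  define Q where "Q z \<longleftrightarrow> B c (fst z) \<and> (\<forall>i<m. g i xs \<noteq> 0 \<longrightarrow> g i (fst z) \<noteq> 0) \<and>
      (\<forall>i. xs $ i \<noteq> 0 \<longrightarrow> fst z $ i \<noteq> 0) \<and> (\<forall>i. xs $ i \<noteq> 0 \<longrightarrow> snd z $ i < 1) \<and>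
      (\<forall>i. ys $ i > 0 \<longrightarrow>
         \<bar>fst z $ i\<bar> * (\<Sum>j | xs $ j \<noteq> 0. \<bar>snd z $ j / fst z $ j\<bar>) < c * snd z $ i)"
    for z :: "(real^'n) \<times> (real^'n)"
  have tf: "((\<lambda>z. fst z $ i) \<longlongrightarrow> xs $ i) (nhds (xs, ys))"
    and ts: "((\<lambda>z. snd z $ i) \<longlongrightarrow> ys $ i) (nhds (xs, ys))" for i
    using tendsto_vec_nth[OF tendsto_fst[OF filterlim_ident]]
      tendsto_vec_nth[OF tendsto_snd[OF filterlim_ident]] by fastforce+
  have fstlim: "filterlim fst (nhds xs) (nhds (xs, ys))"
    using tendsto_fst[OF filterlim_ident, of "(xs, ys)"] by simp
  have "\<forall>\<^sub>F z in nhds (xs, ys). Q z"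
    unfolding Q_def
  proof (intro eventually_conj)
    show "\<forall>\<^sub>F z in nhds (xs, ys). B c (fst z)"
      using B fstlim by (rule eventually_compose_filterlim)
    have g: "\<forall>\<^sub>F z in nhds (xs, ys). g i (fst z) \<noteq> 0" if "i < m" "g i xs \<noteq> 0" for i
    proof -
      have "isCont (g i) xs"
        using assms(2)[OF that(1)] by (auto simp: cont_diff_def intro: differentiable_imp_continuous_within)
      then have "(g i \<longlongrightarrow> g i xs) (nhds xs)" by (simp add: isCont_def tendsto_at_iff_tendsto_nhds)
      from filterlim_compose[OF this fstlim] show ?thesis
        using that(2) by (rule tendsto_imp_eventually_ne)
    qed
    have "\<forall>\<^sub>F z in nhds (xs, ys). \<forall>i\<in>{i. i < m \<and> g i xs \<noteq> 0}. g i (fst z) \<noteq> 0"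
      by (intro eventually_ball_finite) (auto intro: g)
    then show "\<forall>\<^sub>F z in nhds (xs, ys). \<forall>i<m. g i xs \<noteq> 0 \<longrightarrow> g i (fst z) \<noteq> 0"
      by (rule eventually_mono) simp
    show "\<forall>\<^sub>F z in nhds (xs, ys). \<forall>i. xs $ i \<noteq> 0 \<longrightarrow> fst z $ i \<noteq> 0"
      using tendsto_imp_eventually_ne[OF tf]
      by (intro eventually_all_finite) (auto simp: eventually_conj_iff)
    show "\<forall>\<^sub>F z in nhds (xs, ys). \<forall>i. xs $ i \<noteq> 0 \<longrightarrow> snd z $ i < 1"
    proof (intro eventually_all_finite)
      fix i
      show "\<forall>\<^sub>F z in nhds (xs, ys). xs $ i \<noteq> 0 \<longrightarrow> snd z $ i < 1"
        using ys(3)[of i] order_tendstoD(2)[OF ts[of i], of 1] by (auto elim: eventually_mono)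
    qed
    show "\<forall>\<^sub>F z in nhds (xs, ys). \<forall>i. ys $ i > 0 \<longrightarrow>
         \<bar>fst z $ i\<bar> * (\<Sum>j | xs $ j \<noteq> 0. \<bar>snd z $ j / fst z $ j\<bar>) < c * snd z $ i"
    proof (intro eventually_all_finite)
      fix i
      show "\<forall>\<^sub>F z in nhds (xs, ys). ys $ i > 0 \<longrightarrow>
         \<bar>fst z $ i\<bar> * (\<Sum>j | xs $ j \<noteq> 0. \<bar>snd z $ j / fst z $ j\<bar>) < c * snd z $ i"
      proof (cases "ys $ i > 0")
        case True
        have "((\<lambda>z. c * snd z $ i - \<bar>fst z $ i\<bar> * (\<Sum>j | xs $ j \<noteq> 0. \<bar>snd z $ j / fst z $ j\<bar>))
            \<longlongrightarrow> c * ys $ i - \<bar>xs $ i\<bar> * (\<Sum>j | xs $ j \<noteq> 0. \<bar>ys $ j / xs $ j\<bar>)) (nhds (xs, ys))"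
          by (intro tendsto_intros tf ts) auto
        \<comment> \<open>Complementarity gives \<open>xs $ i = 0\<close>, so only
          \<open>c * ys $ i\<close> is left in the limit.\<close>
        moreover have "c * ys $ i - \<bar>xs $ i\<bar> * (\<Sum>j | xs $ j \<noteq> 0. \<bar>ys $ j / xs $ j\<bar>) > 0"
          using True c ys(3)[of i] by auto
        ultimately have "\<forall>\<^sub>F z in nhds (xs, ys).
            0 < c * snd z $ i - \<bar>fst z $ i\<bar> * (\<Sum>j | xs $ j \<noteq> 0. \<bar>snd z $ j / fst z $ j\<bar>)"
          by (rule order_tendstoD(1))
        then show ?thesis by (rule eventually_mono) simp
      qed simp
    qed
  qed
  then obtain U where U: "open U" "(xs, ys) \<in> U" "\<And>z. z \<in> U \<Longrightarrow> Q z"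
    unfolding eventually_nhds by blast
  have "NLP_MFCQ m p g h \<kappa> t (x, y)"
    if t: "t > 0" and xyU: "(x, y) \<in> U" and feas: "NLP_feasible m p g h \<kappa> t (x, y)" for t x y
  proof -
    let ?J = "NLP_ineqs m :: 'n ineq set"
    let ?G = "NLP_G g \<kappa> t"
    have Q: "Q (x, y)" using U(3) xyU .
    have y: "\<And>i. 0 \<le> y $ i" "\<And>i. y $ i \<le> 1" using feas by (auto simp: NLP_feasible_def)
    have "(\<forall>j\<in>?J. ?G j (x, y) = 0 \<longrightarrow> l j = 0) \<and> (\<forall>k<p. \<mu> k = 0)"
      if l: "\<forall>j\<in>{j \<in> ?J. ?G j (x, y) = 0}. 0 \<le> l j"
        and eq: "(\<Sum>j | j \<in> ?J \<and> ?G j (x, y) = 0. l j *\<^sub>R grad (?G j) (x, y))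
           + (\<Sum>k<p. \<mu> k *\<^sub>R grad (NLP_H h k) (x, y)) = 0" for l \<mu>
    proof -
      \<comment> \<open>Extension by 0 from the active constraints, so that sums no longer depend on
        the active set.\<close>
      define L where "L j = (if j \<in> ?J \<and> ?G j (x, y) = 0 then l j else 0)" for j
      define a where "a i = L (XY_upper i) - L (XY_lower i)" for i
      have L0: "0 \<le> L j" for j using l by (simp add: L_def)
      have Lact: "?G j (x, y) = 0" if "L j \<noteq> 0" for j using that by (simp add: L_def split: if_splits)
      have "(\<Sum>j | j \<in> ?J \<and> ?G j (x, y) = 0. l j *\<^sub>R grad (?G j) (x, y))
          = (\<Sum>j\<in>?J. L j *\<^sub>R grad (?G j) (x, y))"
        by (rule sum.mono_neutral_cong_left) (auto simp: L_def finite_NLP_ineqs)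
      with eq have eqL: "(\<Sum>j\<in>?J. L j *\<^sub>R grad (?G j) (x, y))
           + (\<Sum>k<p. \<mu> k *\<^sub>R grad (NLP_H h k) (x, y)) = 0" by simp
      have diff: "\<And>i. i < m \<Longrightarrow> g i differentiable at x" "\<And>i. i < p \<Longrightarrow> h i differentiable at x"
        using assms(2,3) by (auto simp: cont_diff_def)
      note st = NLP_stationarity[where g = g and h = h, OF diff eqL, folded a_def]
      have Lg: "L (G_le i) = 0" if "i < m" "i \<notin> Ig" for i
        using that Q Lact[of "G_le i"] by (auto simp: Q_def Ig_def)
      \<comment> \<open>An active product constraint means that the product is \<open>t\<close> or
        \<open>- t\<close>, and \<open>t > 0\<close>.\<close>
      have xy: "x $ i * y $ i \<noteq> 0" if "a i \<noteq> 0" for i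
      proof -
        have "L (XY_upper i) \<noteq> 0 \<or> L (XY_lower i) \<noteq> 0" using that by (auto simp: a_def)
        then show ?thesis using Lact[of "XY_upper i"] Lact[of "XY_lower i"] t by auto
      qed
      \<comment> \<open>The product cannot equal both \<open>t\<close> and \<open>- t\<close>. Hence
        \<open>a i = 0\<close> will later force both multipliers to vanish, although
        \<open>a i\<close> is only their difference.\<close>
      have one_sided: "L (XY_upper i) = 0 \<or> L (XY_lower i) = 0" for i
        using Lact[of "XY_upper i"] Lact[of "XY_lower i"] t by force
      define R where "R = (\<Sum>i\<in>Ig. \<bar>L (G_le i)\<bar>) + (\<Sum>i<p. \<bar>\<mu> i\<bar>)"
      define S where "S = (\<Sum>i\<in>Ig. L (G_le i) *\<^sub>R grad (g i) x) + (\<Sum>k<p. \<mu> k *\<^sub>R grad (h k) x)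
        + (\<Sum>i | xs $ i = 0. (a i * y $ i) *\<^sub>R axis i 1)"
      have "(\<Sum>i<m. L (G_le i) *\<^sub>R grad (g i) x) = (\<Sum>i\<in>Ig. L (G_le i) *\<^sub>R grad (g i) x)"
        by (rule sum.mono_neutral_right) (auto simp: Lg Ig_def)
      moreover have "(\<Sum>i\<in>UNIV. (a i * y $ i) *\<^sub>R axis i (1::real))
          = (\<Sum>i | xs $ i = 0. (a i * y $ i) *\<^sub>R axis i 1) + (\<Sum>i | xs $ i \<noteq> 0. (a i * y $ i) *\<^sub>R axis i 1)"
        by (subst sum.union_disjoint[symmetric]) (auto intro!: sum.cong)
      \<comment> \<open>\<open>S\<close> is the part of stationarity that CC-MFCQ controls; the
        remaining unit vectors, moved to the other side, bound its norm from above.\<close>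
      ultimately have "S = - (\<Sum>i | xs $ i \<noteq> 0. (a i * y $ i) *\<^sub>R axis i 1)"
        using st(1) unfolding S_def by (simp add: add.assoc eq_neg_iff_add_eq_0)
      then have "norm S \<le> (\<Sum>i | xs $ i \<noteq> 0. \<bar>a i * y $ i\<bar>)"
        by (auto intro!: sum_norm_le)
      moreover have Bx: "B c x" using Q by (simp add: Q_def)
      have "c * (R + (\<Sum>i | xs $ i = 0. \<bar>a i * y $ i\<bar>)) \<le> norm S"
        unfolding R_def S_def
        by (rule Bx[unfolded B_def, rule_format, of "\<lambda>i. L (G_le i)" \<mu> "\<lambda>i. a i * y $ i"])
          (rule L0)
      ultimately have indep: "c * (R + (\<Sum>i | xs $ i = 0. \<bar>a i * y $ i\<bar>))
          \<le> (\<Sum>i | xs $ i \<noteq> 0. \<bar>a i * y $ i\<bar>)" by simp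
      have R0: "R \<ge> 0" by (simp add: R_def sum_nonneg)
      have van: "R = 0 \<and> L Card_le = 0 \<and> (\<forall>i. a i = 0 \<and> L (Y_lower i) = 0 \<and> L (Y_upper i) = 0)"
      proof (rule NLP_multipliers_vanish[OF c R0 L0 assms(4) indep st(2)])
        show "sum (($) y) UNIV = real CARD('n) - real \<kappa>" if "L Card_le \<noteq> 0"
          using Lact[OF that] by simp
      qed (use L0 Lact[of "Y_lower _"] Lact[of "Y_upper _"] xy y ys Q in \<open>auto simp: Q_def\<close>)
      have "(\<Sum>i\<in>Ig. \<bar>L (G_le i)\<bar>) \<ge> 0" "(\<Sum>i<p. \<bar>\<mu> i\<bar>) \<ge> 0" by (auto intro: sum_nonneg)
      then have "(\<Sum>i\<in>Ig. \<bar>L (G_le i)\<bar>) = 0" and \<mu>: "(\<Sum>i<p. \<bar>\<mu> i\<bar>) = 0"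
        using van unfolding R_def by linarith+
      then have "L (G_le i) = 0" if "i < m" for i
        using Lg[OF that] by (cases "i \<in> Ig") (auto simp: sum_nonneg_eq_0_iff Ig_def)
      moreover have "L (XY_upper i) = 0 \<and> L (XY_lower i) = 0" for i
        using van one_sided[of i] by (auto simp: a_def)
      ultimately have "L j = 0" if "j \<in> ?J" for j
        using that van by (auto simp: NLP_ineqs_def)
      then show ?thesis using \<mu> by (force simp: L_def sum_nonneg_eq_0_iff)
    qed
    then show ?thesis
      unfolding NLP_MFCQ_def MFCQ_def Let_def by (auto simp: Ball_def)
  qed
  with U(1,2) show ?thesis by blast
qed

end
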